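(* Let $\alpha>-\frac12$. (1) If $\varphi\in L^1_\alpha$ is nonnegative, then $\mathcal{F}_\alpha(\varphi)\in\mathcal{P}$. (2) If $\varphi\in L^1_\alpha$ is nonnegative, continuous and not identically zero, then $\mathcal{F}_\alpha(\varphi)\in\mathcal{P}^s$.
   Context: $L^1_\alpha$ is the set of even functions $f$ (identified with their restrictions to $[0,\infty)$) with $\int_0^\infty|f(x)|x^{2\alpha+1}dx<\infty$. The normalized Bessel function is the even function $j_\alpha(x)=\sum_{n=0}^{\infty}\frac{(-1)^n\Gamma(\alpha+1)}{n!\,\Gamma(n+\alpha+1)}\left(\frac{x}{2}\right)^{2n}$. The Fourier-Bessel transform is $\mathcal{F}_\alpha f(x)=c_\alpha\int_0^{\infty}f(t)j_\alpha(xt)t^{2\alpha+1}dt$ with $c_\alpha=\frac{1}{2^\alpha\Gamma(\alpha+1)}$; it is regarded as an even function of $x\in\mathbb{R}$. A continuous function $f:\mathbb{R}\to\mathbb{C}$ is positive definite (resp. strictly positive definite) on $\mathbb{R}$ if for every $N\ge1$, all pairwise distinct real numbers $x_1,\dots,x_N$ and all complex numbers $z_1,\dots,z_N$ not all zero, $\sum_{j=1}^N\sum_{k=1}^N z_j\overline{z_k}f(x_j-x_k)\ge0$ (resp. $>0$). $\mathcal{P}$ (resp. $\mathcal{P}^s$) denotes the class of such functions. *)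

theory Defs
  imports "HOL-Analysis.Analysis" "HOL-Library.Complex_Order"
begin

definition even_fun :: "(real \<Rightarrow> complex) \<Rightarrow> bool" where
  "even_fun f \<longleftrightarrow> (\<forall>x. f (- x) = f x)"

text \<open>
  Elements are genuine even functions, not classes modulo null sets. The convention
  \<open>0 powr a = 0\<close> affects the weight at most at the null point \<open>0\<close>.
\<close>

definition L1_weighted :: "real \<Rightarrow> (real \<Rightarrow> complex) set" where
  "L1_weighted \<alpha> = {f. even_fun f \<and> f \<in> borel_measurable lebesgue \<and>
     set_integrable lebesgue {0..} (\<lambda>x. norm (f x) * x powr (2 * \<alpha> + 1))}"

definition bessel_j :: "real \<Rightarrow> real \<Rightarrow> real" where
  "bessel_j \<alpha> x =
     (\<Sum>n. (-1) ^ n * Gamma (\<alpha> + 1) / (fact n * Gamma (real n + \<alpha> + 1)) * (x / 2) ^ (2 * n))"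

definition bessel_const :: "real \<Rightarrow> real" where
  "bessel_const \<alpha> = 1 / (2 powr \<alpha> * Gamma (\<alpha> + 1))"

text \<open>
  Since \<^term>\<open>bessel_j \<alpha>\<close> is even, the formula below directly gives an even function
  on the whole real line.
\<close>

definition fourier_bessel :: "real \<Rightarrow> (real \<Rightarrow> complex) \<Rightarrow> real \<Rightarrow> complex" where
  "fourier_bessel \<alpha> f x =
     of_real (bessel_const \<alpha>) *
     (LINT t:{0..}|lebesgue. f t * of_real (bessel_j \<alpha> (x * t)) * of_real (t powr (2 * \<alpha> + 1)))"

text \<open>
  The order on \<^typ>\<open>complex\<close> is the partial order for which \<open>0 \<le> z\<close> (resp. \<open>0 < z\<close>) means that
  \<open>z\<close> is real and nonnegative (resp. positive).
\<close>

definition positive_definite :: "(real \<Rightarrow> complex) set" where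
  "positive_definite = {f. continuous_on UNIV f \<and>
     (\<forall>N\<ge>1. \<forall>(x :: nat \<Rightarrow> real) (z :: nat \<Rightarrow> complex).
        inj_on x {1..N} \<longrightarrow> (\<exists>j\<in>{1..N}. z j \<noteq> 0) \<longrightarrow>
        0 \<le> (\<Sum>j=1..N. \<Sum>k=1..N. z j * cnj (z k) * f (x j - x k)))}"

definition strictly_positive_definite :: "(real \<Rightarrow> complex) set" where
  "strictly_positive_definite = {f. continuous_on UNIV f \<and>
     (\<forall>N\<ge>1. \<forall>(x :: nat \<Rightarrow> real) (z :: nat \<Rightarrow> complex).
        inj_on x {1..N} \<longrightarrow> (\<exists>j\<in>{1..N}. z j \<noteq> 0) \<longrightarrow>
        0 < (\<Sum>j=1..N. \<Sum>k=1..N. z j * cnj (z k) * f (x j - x k)))}"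

end

theory Submission
  imports Defs
begin

text \<open>
  Poisson's integral exhibits \<open>bessel_j \<alpha>\<close>, for \<open>\<alpha> > - 1 / 2\<close>, as an average of cosines:
  \<open>bessel_j \<alpha> x = E (cos (x * sqrt U))\<close>, where \<open>U\<close> has the Beta distribution with parameters
  \<open>1 / 2\<close> and \<open>\<alpha> + 1 / 2\<close> (\<open>bessel_j_poisson_integral\<close>). This average has nonnegative
  weights, and a cosine is positive definite: the addition formula
  \<open>cos ((x - y) * r) = cos (x * r) * cos (y * r) + sin (x * r) * sin (y * r)\<close> turns its quadratic
  form into \<open>trig_energy\<close>, a sum of two squared moduli (\<open>hermitian_form_cos\<close>). Forming the
  quadratic form commutes with integration (\<open>hermitian_form_integral\<close>). Applied twice, in \<open>u\<close>
  and then in \<open>t\<close>, this writes the quadratic form of the transform of a nonnegative \<open>\<phi>\<close> as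

  \<open>bessel_const \<alpha> * \<integral> \<phi>(t) t\<^sup>2\<^sup>\<alpha>\<^sup>+\<^sup>1 E (trig_energy A x z (t * sqrt U)) dt\<close>,

  which is nonnegative. The transform is continuous by dominated convergence, since
  \<open>\<bar>bessel_j \<alpha>\<bar> \<le> 1\<close>.

  For strictness, suppose that this integral is \<open>0\<close> although the coefficients \<open>z\<close> are not all
  zero. The energy cannot vanish on an interval, because exponentials with distinct frequencies
  are linearly independent on every nonempty open set (\<open>exponentials_independent\<close>), and \<open>U\<close> has a
  positive density on \<open>(0, 1)\<close>; hence the expectation is positive for every \<open>t > 0\<close>
  (\<open>bessel_energy_pos\<close>). So \<open>\<phi>\<close> vanishes almost everywhere on \<open>(0, \<infinity>)\<close>, and then
  everywhere, as it is continuous and even.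
\<close>

section \<open>Poisson's integral for the normalized Bessel function\<close>

text \<open>
  The usual kernel \<open>(1 - s\<^sup>2) powr (\<alpha> - 1 / 2)\<close> of Poisson's integral over \<open>s \<in> [-1, 1]\<close>, written
  in the variable \<open>u = s\<^sup>2\<close>. In this variable the even moments that occur in the cosine series
  are values of Euler's Beta integral.
\<close>
definition poisson_density :: "real \<Rightarrow> real \<Rightarrow> real" where
  "poisson_density \<alpha> u =
     indicator {0..1} u * (u powr (- 1 / 2) * (1 - u) powr (\<alpha> - 1 / 2)) / Beta (1 / 2) (\<alpha> + 1 / 2)"

definition poisson_measure :: "real \<Rightarrow> real measure" where
  "poisson_measure \<alpha> = density lborel (\<lambda>u. ennreal (poisson_density \<alpha> u))"

lemma borel_measurable_poisson_density [measurable]: "poisson_density \<alpha> \<in> borel_measurable borel"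
  unfolding poisson_density_def by measurable

lemma sets_poisson_measure [simp, measurable_cong]: "sets (poisson_measure \<alpha>) = sets borel"
  by (simp add: poisson_measure_def)

lemma space_poisson_measure [simp]: "space (poisson_measure \<alpha>) = UNIV"
  by (simp add: poisson_measure_def)

lemma Beta_real_pos: "0 < a \<Longrightarrow> 0 < b \<Longrightarrow> 0 < Beta a (b :: real)"
  by (simp add: Beta_def)

lemma poisson_density_nonneg: "\<alpha> > - 1 / 2 \<Longrightarrow> 0 \<le> poisson_density \<alpha> u"
  using Beta_real_pos[of "1 / 2" "\<alpha> + 1 / 2"] by (simp add: poisson_density_def)

lemma poisson_density_pos: "\<alpha> > - 1 / 2 \<Longrightarrow> u \<in> {0<..<1} \<Longrightarrow> 0 < poisson_density \<alpha> u"
  using Beta_real_pos[of "1 / 2" "\<alpha> + 1 / 2"] by (simp add: poisson_density_def)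

lemma AE_poisson_measure_unit_interval: "AE u in poisson_measure \<alpha>. u \<in> {0..1}"
  unfolding poisson_measure_def
  by (subst AE_density) (auto simp: poisson_density_def indicator_def)

lemma has_bochner_integral_Beta:
  assumes "0 < a" "0 < (b :: real)"
  shows "has_bochner_integral lborel
           (\<lambda>u. indicator {0..1} u * (u powr (a - 1) * (1 - u) powr (b - 1))) (Beta a b)"
proof (rule has_bochner_integral_nn_integral)
  show "(\<integral>\<^sup>+ u. ennreal (indicator {0..1} u * (u powr (a - 1) * (1 - u) powr (b - 1))) \<partial>lborel)
          = ennreal (Beta a b)"
    using nn_integral_has_integral_lebesgue[OF _ has_integral_Beta_real[OF assms]] by simp
qed (use Beta_real_pos[OF assms] in auto)

lemma poisson_measure_moment:
  assumes "\<alpha> > - 1 / 2"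
  shows "has_bochner_integral (poisson_measure \<alpha>) (\<lambda>u. u ^ n)
           (Beta (real n + 1 / 2) (\<alpha> + 1 / 2) / Beta (1 / 2) (\<alpha> + 1 / 2))"
  unfolding poisson_measure_def
proof (rule has_bochner_integral_density)
  have "has_bochner_integral lborel
     (\<lambda>u. indicator {0..1} u * (u powr (real n + 1 / 2 - 1) * (1 - u) powr (\<alpha> + 1 / 2 - 1))
            / Beta (1 / 2) (\<alpha> + 1 / 2))
     (Beta (real n + 1 / 2) (\<alpha> + 1 / 2) / Beta (1 / 2) (\<alpha> + 1 / 2))"
    using assms by (intro has_bochner_integral_divide_zero has_bochner_integral_Beta) auto
  moreover have "indicator {0..1} u * (u powr (real n + 1 / 2 - 1) * (1 - u) powr (\<alpha> + 1 / 2 - 1))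
            / Beta (1 / 2) (\<alpha> + 1 / 2) = poisson_density \<alpha> u *\<^sub>R u ^ n" for u
    \<comment> \<open>At \<open>u = 0\<close> both sides are \<open>0\<close>, also for \<open>n = 0\<close>, because \<open>0 powr a = 0\<close>.\<close>
  proof (cases "u > 0")
    case True
    then have "u powr (real n + 1 / 2 - 1) = u ^ n * u powr (- 1 / 2)"
      by (simp add: powr_realpow[symmetric] powr_add[symmetric])
    then show ?thesis by (simp add: poisson_density_def algebra_simps)
  qed (auto simp: poisson_density_def indicator_def)
  ultimately show "has_bochner_integral lborel (\<lambda>u. poisson_density \<alpha> u *\<^sub>R u ^ n)
     (Beta (real n + 1 / 2) (\<alpha> + 1 / 2) / Beta (1 / 2) (\<alpha> + 1 / 2))" by simp
qed (use poisson_density_nonneg[OF assms] in auto)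

lemma integral_1_poisson_measure:
  assumes "\<alpha> > - 1 / 2"
  shows "has_bochner_integral (poisson_measure \<alpha>) (\<lambda>_. 1 :: real) 1"
  using poisson_measure_moment[OF assms, of 0] Beta_real_pos[of "1 / 2" "\<alpha> + 1 / 2"] assms by simp

lemma integrable_poisson_measure_bounded:
  fixes f :: "real \<Rightarrow> 'b :: {banach, second_countable_topology}"
  assumes "\<alpha> > - 1 / 2" "f \<in> borel_measurable borel" "\<And>u. norm (f u) \<le> B"
  shows "integrable (poisson_measure \<alpha>) f"
proof (rule Bochner_Integration.integrable_bound)
  show "integrable (poisson_measure \<alpha>) (\<lambda>_. B)"
    using integrable_mult_right[of B "poisson_measure \<alpha>" "\<lambda>_. 1"] integral_1_poisson_measure[OF assms(1)]
    by (simp add: has_bochner_integral_iff)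
  show "AE u in poisson_measure \<alpha>. norm (f u) \<le> norm B"
    using assms(3) by (intro AE_I2) (metis abs_ge_self order_trans real_norm_def)
qed (use assms(2) in simp)

lemma Beta_half_ratio:
  assumes "0 < (b :: real)"
  shows "Beta (real n + 1 / 2) b / Beta (1 / 2) b
           = fact (2 * n) * Gamma (b + 1 / 2) / (4 ^ n * fact n * Gamma (real n + b + 1 / 2))"
proof (induction n)
  case 0
  have "Gamma (b + 1 / 2) > 0" "Beta (1 / 2) b > 0"
    using assms by (auto intro: Beta_real_pos)
  then show ?case by simp
next
  case (Suc n)
  define B G where "B = Beta (real n + 1 / 2) b" and "G = Gamma (real n + b + 1 / 2)"
  have pos: "G > 0" "Beta (1 / 2) b > 0" "real n + 1 / 2 + b > 0"
    using Beta_real_pos[of "1 / 2" b] assms by (auto simp: G_def)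
  have B': "Beta (real (Suc n) + 1 / 2) b = (real n + 1 / 2) / (real n + 1 / 2 + b) * B"
    using Beta_plus1_left[of "real n + 1 / 2" b] pos(3) assms
    by (simp add: B_def field_simps nonpos_Ints_def)
  have G': "Gamma (real (Suc n) + b + 1 / 2) = (real n + 1 / 2 + b) * G"
    using Gamma_plus1[of "real n + b + 1 / 2"] pos(3) by (simp add: G_def add_ac nonpos_Ints_def)
  \<comment> \<open>The two factors \<open>2 * n + 2\<close> and \<open>2 * n + 1\<close> of the factorial give \<open>4 * (n + 1) * (n + 1 / 2)\<close>.\<close>
  have F': "fact (2 * Suc n) / (4 ^ Suc n * fact (Suc n)) =
                   (real n + 1 / 2) * (fact (2 * n) / (4 ^ n * fact n))"
  proof -
    have "fact (2 * Suc n) = (4 * (real n + 1 / 2) * real (Suc n)) * (fact (2 * n) :: real)"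
      by (simp add: algebra_simps)
    then show ?thesis
      by (simp only: fact_Suc[of n] power_Suc) (simp add: divide_simps del: of_nat_Suc)
  qed
  have "Beta (real (Suc n) + 1 / 2) b / Beta (1 / 2) b
      = (real n + 1 / 2) / (real n + 1 / 2 + b) * (B / Beta (1 / 2) b)"
    unfolding B' by simp
  also have "\<dots> = (real n + 1 / 2) / (real n + 1 / 2 + b)
      * (fact (2 * n) * Gamma (b + 1 / 2) / (4 ^ n * fact n * G))"
    unfolding B_def G_def Suc ..
  also have "\<dots> = ((real n + 1 / 2) * (fact (2 * n) / (4 ^ n * fact n)))
      * (Gamma (b + 1 / 2) / ((real n + 1 / 2 + b) * G))"
    by (simp only: times_divide_times_eq times_divide_eq_left times_divide_eq_right
        divide_divide_eq_left mult_ac)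
  also have "\<dots> = fact (2 * Suc n) * Gamma (b + 1 / 2) /
      (4 ^ Suc n * fact (Suc n) * Gamma (real (Suc n) + b + 1 / 2))"
    unfolding F'[symmetric] G'[symmetric] times_divide_times_eq ..
  finally show ?case .
qed

text \<open>
  The cosine series is integrated term by term. By \<open>Beta_half_ratio\<close>, the \<open>n\<close>-th moment turns the
  coefficient of the cosine series into that of the Bessel series; all moments are at most \<open>1\<close>, so
  the exponential series dominates the integrated series.
\<close>
theorem bessel_j_poisson_integral:
  assumes "\<alpha> > - 1 / 2"
  shows "bessel_j \<alpha> x = (\<integral>u. cos (x * sqrt u) \<partial>poisson_measure \<alpha>)"
proof -
  let ?M = "poisson_measure \<alpha>"
  define m where "m n = Beta (real n + 1 / 2) (\<alpha> + 1 / 2) / Beta (1 / 2) (\<alpha> + 1 / 2)" for n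
  define c where "c n = (- 1) ^ n / fact (2 * n) * x ^ (2 * n)" for n
  have int: "integrable ?M (\<lambda>u. c n * u ^ n)" and val: "(\<integral>u. c n * u ^ n \<partial>?M) = c n * m n" for n
    using poisson_measure_moment[OF assms, of n] by (auto simp: has_bochner_integral_iff m_def)
  have summ: "summable (\<lambda>n. norm (c n * y ^ n))" if "y \<ge> 0" for y
  proof (rule summable_comparison_test)
    have "summable (\<lambda>n. inverse (fact n) * (x\<^sup>2 * y) ^ n)"
      by (rule summable_exp)
    then show "summable (\<lambda>n. (x\<^sup>2 * y) ^ n / fact n)"
      by (simp add: divide_inverse mult.commute)
    have "norm (c n * y ^ n) \<le> (x\<^sup>2 * y) ^ n / fact n" for n
    proof -
      have "norm (c n * y ^ n) = (x\<^sup>2 * y) ^ n / fact (2 * n)"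
        using that by (simp add: c_def abs_mult power_mult_distrib power_mult power_abs)
      also have "\<dots> \<le> (x\<^sup>2 * y) ^ n / fact n"
        using that by (intro divide_left_mono fact_mono) auto
      finally show ?thesis .
    qed
    then show "\<exists>N. \<forall>n\<ge>N. norm (norm (c n * y ^ n)) \<le> (x\<^sup>2 * y) ^ n / fact n" by auto
  qed
  have abs_int: "(\<integral>u. norm (c n * u ^ n) \<partial>?M) \<le> norm (c n)" for n
  proof -
    have "(\<integral>u. norm (c n * u ^ n) \<partial>?M) \<le> (\<integral>u. norm (c n) * 1 \<partial>?M)"
    proof (rule integral_mono_AE)
      show "integrable ?M (\<lambda>u. norm (c n) * 1)"
        by (rule integrable_poisson_measure_bounded[OF assms]) auto
      show "AE u in ?M. norm (c n * u ^ n) \<le> norm (c n) * 1"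
        using AE_poisson_measure_unit_interval
        by eventually_elim (auto simp: abs_mult intro!: mult_left_le power_le_one)
    qed (use int[of n] in auto)
    also have "\<dots> = norm (c n)"
      using integral_1_poisson_measure[OF assms] by (simp add: has_bochner_integral_iff)
    finally show ?thesis .
  qed
  have "(\<lambda>n. \<integral>u. c n * u ^ n \<partial>?M) sums (\<integral>u. (\<Sum>n. c n * u ^ n) \<partial>?M)"
  proof (rule sums_integral)
    show "AE u in ?M. summable (\<lambda>n. norm (c n * u ^ n))"
      using AE_poisson_measure_unit_interval by eventually_elim (rule summ, simp)
    show "summable (\<lambda>n. \<integral>u. norm (c n * u ^ n) \<partial>?M)"
      using summ[of 1] abs_int by (intro summable_comparison_test[OF _ summ[of 1]]) auto
  qed (rule int)
  moreover have "(\<integral>u. (\<Sum>n. c n * u ^ n) \<partial>?M) = (\<integral>u. cos (x * sqrt u) \<partial>?M)"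
  proof (rule integral_cong_AE)
    \<comment> \<open>The support matters: for negative \<open>u\<close> the power series has the value \<open>cosh (x * sqrt (- u))\<close>.\<close>
    show "AE u in ?M. (\<Sum>n. c n * u ^ n) = cos (x * sqrt u)"
      using AE_poisson_measure_unit_interval
    proof eventually_elim
      case (elim u)
      then have "c n * u ^ n = (- 1) ^ n / fact (2 * n) * (x * sqrt u) ^ (2 * n)" for n
        by (simp add: c_def power_mult_distrib power_mult)
      then show ?case using cos_paired[of "x * sqrt u"] by (simp add: sums_iff)
    qed
  qed (use int in auto)
  moreover have "(\<integral>u. c n * u ^ n \<partial>?M) =
      (-1) ^ n * Gamma (\<alpha> + 1) / (fact n * Gamma (real n + \<alpha> + 1)) * (x / 2) ^ (2 * n)" for n
  proof -
    have "m n = fact (2 * n) * Gamma (\<alpha> + 1) / (4 ^ n * fact n * Gamma (real n + \<alpha> + 1))"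
      using Beta_half_ratio[of "\<alpha> + 1 / 2" n] assms by (simp add: m_def add_ac)
    then show ?thesis unfolding val by (simp add: c_def power_divide power_mult) (simp only: mult_ac)
  qed
  ultimately show ?thesis by (simp add: bessel_j_def sums_iff)
qed

section \<open>Continuity of integrals depending on a parameter\<close>

lemma continuous_on_integral_dominated:
  fixes f :: "real \<Rightarrow> 'a \<Rightarrow> real"
  assumes "\<And>t. continuous_on UNIV (\<lambda>x. f x t)" "\<And>x. f x \<in> borel_measurable M"
    and "integrable M w" "\<And>x t. \<bar>f x t\<bar> \<le> w t"
  shows "continuous_on UNIV (\<lambda>x. \<integral>t. f x t \<partial>M)"
  unfolding continuous_on_sequentially
proof safe
  fix X :: "nat \<Rightarrow> real" and a assume X: "X \<longlonglongrightarrow> a"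
  have "(\<lambda>n. \<integral>t. f (X n) t \<partial>M) \<longlonglongrightarrow> (\<integral>t. f a t \<partial>M)"
  proof (rule integral_dominated_convergence)
    show "AE t in M. (\<lambda>n. f (X n) t) \<longlonglongrightarrow> f a t"
      using assms(1) X by (auto simp: continuous_on_sequentially o_def)
  qed (use assms in auto)
  then show "((\<lambda>x. \<integral>t. f x t \<partial>M) \<circ> X) \<longlonglongrightarrow> (\<integral>t. f a t \<partial>M)" by (simp add: o_def)
qed

lemma abs_bessel_j_le_1:
  assumes "\<alpha> > - 1 / 2"
  shows "\<bar>bessel_j \<alpha> x\<bar> \<le> 1"
proof -
  have "\<bar>bessel_j \<alpha> x\<bar> \<le> (\<integral>u. \<bar>cos (x * sqrt u)\<bar> \<partial>poisson_measure \<alpha>)"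
    using integral_norm_bound[of "poisson_measure \<alpha>" "\<lambda>u. cos (x * sqrt u)"]
    by (simp add: bessel_j_poisson_integral[OF assms])
  also have "\<dots> \<le> (\<integral>u. 1 \<partial>poisson_measure \<alpha>)"
    by (intro integral_mono integrable_poisson_measure_bounded[OF assms, where B = 1]) auto
  also have "\<dots> = 1"
    using integral_1_poisson_measure[OF assms] by (simp add: has_bochner_integral_iff)
  finally show ?thesis .
qed

lemma continuous_on_bessel_j:
  assumes "\<alpha> > - 1 / 2"
  shows "continuous_on UNIV (bessel_j \<alpha>)"
  unfolding bessel_j_poisson_integral[OF assms]
  by (rule continuous_on_integral_dominated[where w = "\<lambda>_. 1"])
     (auto intro!: continuous_intros integrable_poisson_measure_bounded[OF assms, where B = 1])

section \<open>Quadratic forms and the linear independence of exponentials\<close>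

definition hermitian_form ::
    "'i set \<Rightarrow> ('i \<Rightarrow> real) \<Rightarrow> ('i \<Rightarrow> complex) \<Rightarrow> (real \<Rightarrow> complex) \<Rightarrow> complex" where
  "hermitian_form A x z f = (\<Sum>j\<in>A. \<Sum>k\<in>A. z j * cnj (z k) * f (x j - x k))"

text \<open>The quadratic form of \<open>\<lambda>y. cos (y * r)\<close>, in the shape that the addition formula gives it.\<close>
definition trig_energy :: "'i set \<Rightarrow> ('i \<Rightarrow> real) \<Rightarrow> ('i \<Rightarrow> complex) \<Rightarrow> real \<Rightarrow> real" where
  "trig_energy A x z r =
     (cmod (\<Sum>j\<in>A. z j * of_real (cos (x j * r))))\<^sup>2 +
     (cmod (\<Sum>j\<in>A. z j * of_real (sin (x j * r))))\<^sup>2"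

lemma trig_energy_nonneg: "0 \<le> trig_energy A x z r"
  by (simp add: trig_energy_def)

lemma continuous_on_trig_energy: "continuous_on UNIV (trig_energy A x z)"
  unfolding trig_energy_def by (intro continuous_intros)

lemma borel_measurable_trig_energy [measurable]: "trig_energy A x z \<in> borel_measurable borel"
  by (intro borel_measurable_continuous_onI continuous_on_trig_energy)

lemma hermitian_form_cos:
  "hermitian_form A x z (\<lambda>y. of_real (cos (y * r))) = of_real (trig_energy A x z r)"
proof -
  have "of_real (trig_energy A x z r) =
     (\<Sum>j\<in>A. z j * of_real (cos (x j * r))) * cnj (\<Sum>j\<in>A. z j * of_real (cos (x j * r))) +
     (\<Sum>j\<in>A. z j * of_real (sin (x j * r))) * cnj (\<Sum>j\<in>A. z j * of_real (sin (x j * r)))"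
    by (simp only: trig_energy_def of_real_add complex_norm_square)
  also have "\<dots> = hermitian_form A x z (\<lambda>y. of_real (cos (y * r)))"
  proof -
    have "z j * cnj (z k) * complex_of_real (cos ((x j - x k) * r)) =
        z j * of_real (cos (x j * r)) * cnj (z k * of_real (cos (x k * r))) +
        z j * of_real (sin (x j * r)) * cnj (z k * of_real (sin (x k * r)))" for j k
      unfolding left_diff_distrib cos_diff
      by (simp only: of_real_add of_real_mult complex_cnj_mult complex_cnj_complex_of_real
            distrib_left mult_ac)
    then show ?thesis
      by (simp only: hermitian_form_def cnj_sum sum_product sum.distrib)
  qed
  finally show ?thesis ..
qed

lemma hermitian_form_scale: "hermitian_form A x z (\<lambda>y. c * f y) = c * hermitian_form A x z f"
  by (simp add: hermitian_form_def sum_distrib_left mult_ac)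

lemma hermitian_form_integral:
  assumes "\<And>y. integrable M (\<lambda>t. f t y)"
  shows "integrable M (\<lambda>t. hermitian_form A x z (f t))"
    and "hermitian_form A x z (\<lambda>y. \<integral>t. f t y \<partial>M) = (\<integral>t. hermitian_form A x z (f t) \<partial>M)"
  using assms by (auto simp: hermitian_form_def)

text \<open>
  Dividing a vanishing combination by one of its exponentials makes that term constant, and
  differentiation removes it. The other coefficients are multiplied by the nonzero differences
  \<open>w j - w a\<close>, so induction on the number of exponentials applies.
\<close>
lemma exponentials_independent:
  fixes w c :: "'i \<Rightarrow> complex"
  assumes "finite A" "inj_on w A" "open S" "S \<noteq> {}"
    and "\<And>r. r \<in> S \<Longrightarrow> (\<Sum>j\<in>A. c j * exp (w j * of_real r)) = 0"
    and "j \<in> A"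
  shows "c j = 0"
  using assms(1,2,5,6)
proof (induction A arbitrary: w c j rule: finite_induct)
  case (insert a A)
  let ?v = "\<lambda>j. w j - w a"
  have "(\<Sum>j\<in>A. c j * ?v j * exp (?v j * of_real r)) = 0" if r: "r \<in> S" for r
  proof -
    let ?g = "\<lambda>s. \<Sum>j\<in>insert a A. c j * exp (?v j * s)"
    have "(?g has_field_derivative (\<Sum>j\<in>insert a A. c j * ?v j * exp (?v j * of_real r)))
            (at (of_real r))"
      by (intro DERIV_sum) (auto intro!: derivative_eq_intros)
    then have "((\<lambda>s. ?g (of_real s)) has_vector_derivative
            (\<Sum>j\<in>insert a A. c j * ?v j * exp (?v j * of_real r))) (at r)"
      by (rule has_vector_derivative_real_field)
    moreover have "((\<lambda>s. ?g (of_real s)) has_vector_derivative 0) (at r)"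
    proof (rule has_vector_derivative_transform_within_open[OF has_vector_derivative_const \<open>open S\<close> r])
      fix s assume "s \<in> S"
      have "?g (of_real s) =
          (\<Sum>j\<in>insert a A. c j * exp (w j * of_real s)) / exp (w a * of_real s)"
        unfolding sum_divide_distrib by (simp add: left_diff_distrib exp_diff)
      then show "0 = ?g (of_real s)" using insert.prems(2)[OF \<open>s \<in> S\<close>] by simp
    qed
    ultimately have "(\<Sum>j\<in>insert a A. c j * ?v j * exp (?v j * of_real r)) = 0"
      by (rule vector_derivative_unique_at)
    then show ?thesis using insert.hyps by simp
  qed
  moreover have "inj_on ?v A" using insert.prems(1) by (auto simp: inj_on_def)
  ultimately have "c i * ?v i = 0" if "i \<in> A" for i
    using insert.IH[of ?v "\<lambda>j. c j * ?v j" i] that by blast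
  moreover have "?v i \<noteq> 0" if "i \<in> A" for i
    using insert.prems(1) insert.hyps that by (auto simp: inj_on_def)
  ultimately have A: "c i = 0" if "i \<in> A" for i using that by auto
  obtain r where "r \<in> S" using \<open>S \<noteq> {}\<close> by auto
  from insert.prems(2)[OF this] have "c a = 0" using insert.hyps A by simp
  then show ?case using A insert.prems(3) by auto
qed auto

text \<open>
  Both squares in the energy vanish only if \<open>\<Sum> z j * exp (i * x j * r)\<close> vanishes, by Euler's
  formula.
\<close>
lemma trig_energy_pos_on_open:
  assumes "finite A" "inj_on x A" "j \<in> A" "z j \<noteq> 0" "open S" "S \<noteq> {}"
  obtains r where "r \<in> S" "0 < trig_energy A x z r"
proof -
  have "\<exists>r\<in>S. trig_energy A x z r \<noteq> 0"
  proof (rule ccontr)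
    assume "\<not> ?thesis"
    then have zero: "trig_energy A x z r = 0" if "r \<in> S" for r using that by blast
    have "z j = 0"
    proof (rule exponentials_independent[where w = "\<lambda>j. \<i> * of_real (x j)"])
      fix r assume "r \<in> S"
      have euler: "exp (\<i> * of_real (x j) * of_real r) =
          of_real (cos (x j * r)) + \<i> * of_real (sin (x j * r))" for j
        unfolding mult.assoc of_real_mult[symmetric] cis_conv_exp[symmetric]
        by (simp add: complex_eq_iff)
      have "(\<Sum>j\<in>A. z j * exp (\<i> * of_real (x j) * of_real r)) =
          (\<Sum>j\<in>A. z j * of_real (cos (x j * r))) + \<i> * (\<Sum>j\<in>A. z j * of_real (sin (x j * r)))"
        unfolding euler distrib_left sum.distrib sum_distrib_left
        by (simp only: mult.left_commute)
      also have "\<dots> = 0"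
        using zero[OF \<open>r \<in> S\<close>] by (simp add: trig_energy_def add_nonneg_eq_0_iff)
      finally show "(\<Sum>j\<in>A. z j * exp (\<i> * of_real (x j) * of_real r)) = 0" .
    qed (use assms in \<open>auto simp: inj_on_def\<close>)
    then show False using assms by simp
  qed
  then show ?thesis using that trig_energy_nonneg[of A x z] by (metis order_le_less)
qed

section \<open>The quadratic form of a dilated Bessel function\<close>

definition bessel_energy :: "real \<Rightarrow> 'i set \<Rightarrow> ('i \<Rightarrow> real) \<Rightarrow> ('i \<Rightarrow> complex) \<Rightarrow> real \<Rightarrow> real" where
  "bessel_energy \<alpha> A x z t = (\<integral>u. trig_energy A x z (t * sqrt u) \<partial>poisson_measure \<alpha>)"

lemma trig_energy_le: "trig_energy A x z r \<le> 2 * (\<Sum>j\<in>A. cmod (z j))\<^sup>2"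
proof -
  have "cmod (\<Sum>j\<in>A. z j * of_real (g j)) \<le> (\<Sum>j\<in>A. cmod (z j))"
    if "\<And>j. \<bar>g j\<bar> \<le> 1" for g :: "'a \<Rightarrow> real"
    using that by (intro sum_norm_le) (simp add: norm_mult mult_left_le)
  then show ?thesis
    unfolding trig_energy_def mult_2 by (intro add_mono power_mono) auto
qed

lemma integrable_trig_energy:
  "\<alpha> > - 1 / 2 \<Longrightarrow> integrable (poisson_measure \<alpha>) (\<lambda>u. trig_energy A x z (t * sqrt u))"
  by (rule integrable_poisson_measure_bounded[where B = "2 * (\<Sum>j\<in>A. cmod (z j))\<^sup>2"])
     (auto simp: trig_energy_nonneg trig_energy_le)

lemma bessel_energy_nonneg: "0 \<le> bessel_energy \<alpha> A x z t"
  by (simp add: bessel_energy_def trig_energy_nonneg)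

lemma continuous_on_bessel_energy:
  assumes "\<alpha> > - 1 / 2"
  shows "continuous_on UNIV (bessel_energy \<alpha> A x z)"
  unfolding bessel_energy_def
proof (rule continuous_on_integral_dominated)
  show "integrable (poisson_measure \<alpha>) (\<lambda>_. 2 * (\<Sum>j\<in>A. cmod (z j))\<^sup>2)"
    using assms by (intro integrable_poisson_measure_bounded) auto
qed (auto simp: trig_energy_nonneg trig_energy_le
       intro!: continuous_on_compose2[OF continuous_on_trig_energy] continuous_intros)

lemma hermitian_form_bessel_j:
  assumes "\<alpha> > - 1 / 2"
  shows "hermitian_form A x z (\<lambda>y. of_real (bessel_j \<alpha> (y * t))) =
           of_real (bessel_energy \<alpha> A x z t)"
proof -
  let ?M = "poisson_measure \<alpha>"
  have "hermitian_form A x z (\<lambda>y. of_real (bessel_j \<alpha> (y * t))) =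
      hermitian_form A x z (\<lambda>y. \<integral>u. of_real (cos (y * (t * sqrt u))) \<partial>?M)"
    by (simp add: bessel_j_poisson_integral[OF assms] mult.assoc)
  also have "\<dots> = (\<integral>u. of_real (trig_energy A x z (t * sqrt u)) \<partial>?M)"
    by (subst hermitian_form_integral(2))
       (auto simp: hermitian_form_cos intro!: integrable_poisson_measure_bounded[OF assms, where B = 1])
  finally show ?thesis by (simp add: bessel_energy_def)
qed

text \<open>
  If the average of the nonnegative energy over \<open>r = t * sqrt u\<close> were \<open>0\<close>, the energy would vanish
  for almost all \<open>r \<in> (0, t)\<close>, since the density is positive on \<open>(0, 1)\<close>; by continuity it would
  vanish on the whole interval, contradicting \<open>trig_energy_pos_on_open\<close>.
\<close>
lemma bessel_energy_pos:
  assumes "\<alpha> > - 1 / 2" "finite A" "inj_on x A" "j \<in> A" "z j \<noteq> 0" "0 < t"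
  shows "0 < bessel_energy \<alpha> A x z t"
proof (rule ccontr)
  assume "\<not> ?thesis"
  then have "bessel_energy \<alpha> A x z t = 0"
    using bessel_energy_nonneg[of \<alpha> A x z t] by simp
  then have "AE u in poisson_measure \<alpha>. trig_energy A x z (t * sqrt u) = 0"
    using integral_nonneg_eq_0_iff_AE[OF integrable_trig_energy[OF assms(1), of A x z t]]
    by (simp add: bessel_energy_def trig_energy_nonneg)
  then have "AE u in lborel. 0 < poisson_density \<alpha> u \<longrightarrow> trig_energy A x z (t * sqrt u) = 0"
    unfolding poisson_measure_def by (subst (asm) AE_density) auto
  then have "AE u in lebesgue. u \<in> {0<..<1} \<longrightarrow> u \<in> {u. trig_energy A x z (t * sqrt u) = 0}"
    by (intro AE_completion) (auto elim!: eventually_mono simp: poisson_density_pos[OF assms(1)])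
  moreover have "closed {u. trig_energy A x z (t * sqrt u) = 0}"
    by (intro closed_Collect_eq continuous_intros continuous_on_compose2[OF continuous_on_trig_energy]) auto
  ultimately have zero: "trig_energy A x z (t * sqrt u) = 0" if "u \<in> {0<..<1}" for u
    using mem_closed_if_AE_lebesgue_open[of "{0<..<1}" "{u. trig_energy A x z (t * sqrt u) = 0}" u] that
    by auto
  obtain r where r: "r \<in> {0<..<t}" "0 < trig_energy A x z r"
    using trig_energy_pos_on_open[of A x j z "{0<..<t}"] assms by auto
  then have "(r / t)\<^sup>2 \<in> {0<..<1}" by (auto simp: power_less_one_iff)
  with zero[of "(r / t)\<^sup>2"] r show False by simp
qed

section \<open>The Fourier-Bessel transform of a nonnegative function\<close>

text \<open>
  For nonnegative \<open>\<phi>\<close> the real part is \<open>\<phi>\<close> itself. A real-valued density makes the results on signs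
  of real integrals applicable.
\<close>
definition bessel_weight :: "real \<Rightarrow> (real \<Rightarrow> complex) \<Rightarrow> real \<Rightarrow> real" where
  "bessel_weight \<alpha> \<phi> t = indicator {0..} t * (Re (\<phi> t) * t powr (2 * \<alpha> + 1))"

lemma bessel_const_pos: "\<alpha> > - 1 / 2 \<Longrightarrow> 0 < bessel_const \<alpha>"
  by (simp add: bessel_const_def)

lemma bessel_weight_nonneg: "(\<And>t. 0 \<le> \<phi> t) \<Longrightarrow> 0 \<le> bessel_weight \<alpha> \<phi> t"
  by (simp add: bessel_weight_def less_eq_complex_def)

lemma integrable_bessel_weight:
  assumes "\<phi> \<in> L1_weighted \<alpha>" "\<And>t. 0 \<le> \<phi> t"
  shows "integrable lebesgue (bessel_weight \<alpha> \<phi>)"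
proof -
  have "cmod (\<phi> t) = Re (\<phi> t)" for t
    using assms(2)[of t] by (simp add: less_eq_complex_def cmod_eq_Re)
  then show ?thesis
    using assms(1) by (simp add: L1_weighted_def set_integrable_def bessel_weight_def[abs_def])
qed

lemma integrable_bessel_weight_mult:
  assumes "\<phi> \<in> L1_weighted \<alpha>" "\<And>t. 0 \<le> \<phi> t"
    and "continuous_on UNIV g" "\<And>t. \<bar>g t\<bar> \<le> B"
  shows "integrable lebesgue (\<lambda>t. bessel_weight \<alpha> \<phi> t * g t)"
proof (rule Bochner_Integration.integrable_bound)
  have W: "integrable lebesgue (bessel_weight \<alpha> \<phi>)"
    by (rule integrable_bessel_weight[OF assms(1,2)])
  then show "integrable lebesgue (\<lambda>t. bessel_weight \<alpha> \<phi> t * B)" by simp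
  have "g \<in> borel_measurable lebesgue"
    using borel_measurable_continuous_onI[OF assms(3)] by (simp add: measurable_completion)
  then show "(\<lambda>t. bessel_weight \<alpha> \<phi> t * g t) \<in> borel_measurable lebesgue"
    using borel_measurable_integrable[OF W] by measurable
  show "AE t in lebesgue. norm (bessel_weight \<alpha> \<phi> t * g t) \<le> norm (bessel_weight \<alpha> \<phi> t * B)"
  proof (rule AE_I2)
    fix t
    have "\<bar>g t\<bar> \<le> \<bar>B\<bar>" using assms(4)[of t] by simp
    then show "norm (bessel_weight \<alpha> \<phi> t * g t) \<le> norm (bessel_weight \<alpha> \<phi> t * B)"
      by (simp add: abs_mult mult_left_mono)
  qed
qed

lemma integrable_bessel_weight_bessel_j:
  assumes "\<alpha> > - 1 / 2" "\<phi> \<in> L1_weighted \<alpha>" "\<And>t. 0 \<le> \<phi> t"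
  shows "integrable lebesgue (\<lambda>t. bessel_weight \<alpha> \<phi> t * bessel_j \<alpha> (x * t))"
  by (rule integrable_bessel_weight_mult[OF assms(2,3) _ abs_bessel_j_le_1[OF assms(1)]])
     (auto intro!: continuous_on_compose2[OF continuous_on_bessel_j[OF assms(1)]] continuous_intros)

lemma fourier_bessel_nonneg_eq:
  assumes "\<And>t. 0 \<le> \<phi> t"
  shows "fourier_bessel \<alpha> \<phi> x =
    of_real (bessel_const \<alpha>) *
      (\<integral>t. of_real (bessel_weight \<alpha> \<phi> t * bessel_j \<alpha> (x * t)) \<partial>lebesgue)"
proof -
  have real: "\<phi> t = of_real (Re (\<phi> t))" for t
    using assms[of t] by (simp add: less_eq_complex_def complex_eq_iff)
  have "indicator {0..} t *\<^sub>R
       (\<phi> t * of_real (bessel_j \<alpha> (x * t)) * of_real (t powr (2 * \<alpha> + 1))) =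
     of_real (bessel_weight \<alpha> \<phi> t * bessel_j \<alpha> (x * t))" for t
    by (subst real) (simp add: bessel_weight_def scaleR_conv_of_real mult_ac)
  then show ?thesis by (simp add: fourier_bessel_def set_lebesgue_integral_def)
qed

lemma continuous_on_fourier_bessel:
  assumes "\<alpha> > - 1 / 2" "\<phi> \<in> L1_weighted \<alpha>" "\<And>t. 0 \<le> \<phi> t"
  shows "continuous_on UNIV (fourier_bessel \<alpha> \<phi>)"
proof -
  have "continuous_on UNIV (\<lambda>x. \<integral>t. bessel_weight \<alpha> \<phi> t * bessel_j \<alpha> (x * t) \<partial>lebesgue)"
  proof (rule continuous_on_integral_dominated)
    show "integrable lebesgue (bessel_weight \<alpha> \<phi>)"
      by (rule integrable_bessel_weight[OF assms(2,3)])
    show "\<bar>bessel_weight \<alpha> \<phi> t * bessel_j \<alpha> (x * t)\<bar> \<le> bessel_weight \<alpha> \<phi> t" for x t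
      using abs_bessel_j_le_1[OF assms(1), of "x * t"] bessel_weight_nonneg[OF assms(3)]
      by (simp add: abs_mult mult_left_le)
    show "(\<lambda>t. bessel_weight \<alpha> \<phi> t * bessel_j \<alpha> (x * t)) \<in> borel_measurable lebesgue" for x
      using integrable_bessel_weight_bessel_j[OF assms] by (rule borel_measurable_integrable)
  qed (intro continuous_intros continuous_on_compose2[OF continuous_on_bessel_j[OF assms(1)]]; simp)
  then show ?thesis
    unfolding fourier_bessel_nonneg_eq[OF assms(3)] integral_complex_of_real
    by (intro continuous_intros)
qed

lemma hermitian_form_fourier_bessel:
  assumes "\<alpha> > - 1 / 2" "\<phi> \<in> L1_weighted \<alpha>" "\<And>t. 0 \<le> \<phi> t"
  shows "integrable lebesgue (\<lambda>t. bessel_weight \<alpha> \<phi> t * bessel_energy \<alpha> A x z t)"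
    and "hermitian_form A x z (fourier_bessel \<alpha> \<phi>) =
      of_real (bessel_const \<alpha> * (\<integral>t. bessel_weight \<alpha> \<phi> t * bessel_energy \<alpha> A x z t \<partial>lebesgue))"
proof -
  let ?f = "\<lambda>t y. complex_of_real (bessel_weight \<alpha> \<phi> t * bessel_j \<alpha> (y * t))"
  have int: "integrable lebesgue (\<lambda>t. ?f t y)" for y
    using integrable_bessel_weight_bessel_j[OF assms] by (rule integrable_of_real)
  have eq: "hermitian_form A x z (?f t) =
      complex_of_real (bessel_weight \<alpha> \<phi> t * bessel_energy \<alpha> A x z t)" for t
    by (simp add: hermitian_form_scale hermitian_form_bessel_j[OF assms(1)])
  show "integrable lebesgue (\<lambda>t. bessel_weight \<alpha> \<phi> t * bessel_energy \<alpha> A x z t)"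
    using hermitian_form_integral(1)[where f = ?f and A = A and x = x and z = z, OF int]
    unfolding eq by (simp only: complex_of_real_integrable_eq)
  have "hermitian_form A x z (fourier_bessel \<alpha> \<phi>) =
      of_real (bessel_const \<alpha>) * hermitian_form A x z (\<lambda>y. \<integral>t. ?f t y \<partial>lebesgue)"
    unfolding fourier_bessel_nonneg_eq[OF assms(3), abs_def] hermitian_form_scale ..
  also have "\<dots> = of_real (bessel_const \<alpha>) * (\<integral>t. hermitian_form A x z (?f t) \<partial>lebesgue)"
    by (simp only: hermitian_form_integral(2)[where f = ?f, OF int])
  also have "\<dots> =
      of_real (bessel_const \<alpha> * (\<integral>t. bessel_weight \<alpha> \<phi> t * bessel_energy \<alpha> A x z t \<partial>lebesgue))"
    by (simp only: eq integral_complex_of_real of_real_mult[of "bessel_const \<alpha>"])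
  finally show "hermitian_form A x z (fourier_bessel \<alpha> \<phi>) =
      of_real (bessel_const \<alpha> * (\<integral>t. bessel_weight \<alpha> \<phi> t * bessel_energy \<alpha> A x z t \<partial>lebesgue))" .
qed

lemma fourier_bessel_form_nonneg:
  assumes "\<alpha> > - 1 / 2" "\<phi> \<in> L1_weighted \<alpha>" "\<And>t. 0 \<le> \<phi> t"
  shows "0 \<le> hermitian_form A x z (fourier_bessel \<alpha> \<phi>)"
proof -
  have "0 \<le> (\<integral>t. bessel_weight \<alpha> \<phi> t * bessel_energy \<alpha> A x z t \<partial>lebesgue)"
    by (intro Bochner_Integration.integral_nonneg mult_nonneg_nonneg
          bessel_weight_nonneg[OF assms(3)] bessel_energy_nonneg)
  then show ?thesis
    using bessel_const_pos[OF assms(1)]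
    by (simp add: hermitian_form_fourier_bessel(2)[OF assms] less_eq_complex_def)
qed

text \<open>
  The transform only sees the values at positive arguments, so a function that is not identically
  zero has to be nonzero at one of these: evenness excludes the case that it is supported on the
  negative half-line, continuity the case that it is supported at \<open>0\<close>.
\<close>
lemma even_continuous_nonzero_at_pos:
  fixes \<phi> :: "real \<Rightarrow> complex"
  assumes "even_fun \<phi>" "continuous_on UNIV \<phi>" "\<phi> s \<noteq> 0"
  obtains t where "0 < t" "\<phi> t \<noteq> 0"
proof -
  have "\<exists>t>0. \<phi> t \<noteq> 0"
  proof (rule ccontr)
    assume "\<not> ?thesis"
    then have zero: "\<phi> t = 0" if "0 < t" for t using that by blast
    have "\<phi> t = 0" for t
    proof -
      have nonneg: "\<phi> t = 0" if "0 \<le> t" for t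
      proof (rule continuous_constant_on_closure[of "{0<..}" \<phi>])
        show "continuous_on (closure {0<..}) \<phi>" using assms(2) continuous_on_subset by blast
      qed (use zero that in auto)
      show ?thesis
        using nonneg[of t] nonneg[of "- t"] assms(1) by (cases "0 \<le> t") (auto simp: even_fun_def)
    qed
    then show False using assms(3) by simp
  qed
  then show ?thesis using that by blast
qed

text \<open>
  Since \<open>bessel_energy\<close> is positive on \<open>(0, \<infinity>)\<close>, a vanishing integral forces \<open>\<phi> = 0\<close> almost
  everywhere there. The zero set of \<open>\<phi>\<close> is closed, hence contains all of \<open>(0, \<infinity>)\<close>.
\<close>
lemma fourier_bessel_form_pos:
  assumes "\<alpha> > - 1 / 2" "\<phi> \<in> L1_weighted \<alpha>" "\<And>t. 0 \<le> \<phi> t"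
    and "continuous_on UNIV \<phi>" "\<phi> s \<noteq> 0"
    and "finite A" "inj_on x A" "j \<in> A" "z j \<noteq> 0"
  shows "0 < hermitian_form A x z (fourier_bessel \<alpha> \<phi>)"
proof -
  let ?h = "\<lambda>t. bessel_weight \<alpha> \<phi> t * bessel_energy \<alpha> A x z t"
  have h_nonneg: "0 \<le> ?h t" for t
    by (intro mult_nonneg_nonneg bessel_weight_nonneg[OF assms(3)] bessel_energy_nonneg)
  have "(\<integral>t. ?h t \<partial>lebesgue) \<noteq> 0"
  proof
    assume "(\<integral>t. ?h t \<partial>lebesgue) = 0"
    then have "AE t in lebesgue. ?h t = 0"
      using integral_nonneg_eq_0_iff_AE[OF hermitian_form_fourier_bessel(1)[OF assms(1-3), of A x z]]
        h_nonneg by simp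
    then have ae: "AE t in lebesgue. t \<in> {0<..} \<longrightarrow> t \<in> {t. \<phi> t = 0}"
    proof eventually_elim
      case (elim t)
      have "bessel_energy \<alpha> A x z t \<noteq> 0" if "0 < t"
        using bessel_energy_pos[of \<alpha> A x j z t] assms that by simp
      with elim have "Re (\<phi> t) = 0" if "0 < t" using that by (auto simp: bessel_weight_def)
      with assms(3)[of t] show ?case by (auto simp: less_eq_complex_def complex_eq_iff)
    qed
    have "closed {t. \<phi> t = 0}"
      using assms(4) by (intro closed_Collect_eq) auto
    with ae have "\<phi> t = 0" if "0 < t" for t
      using mem_closed_if_AE_lebesgue_open[of "{0<..}" "{t. \<phi> t = 0}" t] that by simp
    moreover have "even_fun \<phi>" using assms(2) by (simp add: L1_weighted_def)
    ultimately show False using even_continuous_nonzero_at_pos[of \<phi> s] assms(4,5) by metis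
  qed
  moreover have "0 \<le> (\<integral>t. ?h t \<partial>lebesgue)"
    by (intro Bochner_Integration.integral_nonneg h_nonneg)
  ultimately show ?thesis
    using bessel_const_pos[OF assms(1)]
    by (simp add: hermitian_form_fourier_bessel(2)[OF assms(1-3)] less_complex_def)
qed

theorem theorem5:
  fixes \<alpha> :: real
  assumes "\<alpha> > - 1 / 2"
  shows "(\<forall>\<phi> \<in> L1_weighted \<alpha>. (\<forall>x. 0 \<le> \<phi> x) \<longrightarrow>
            fourier_bessel \<alpha> \<phi> \<in> positive_definite) \<and>
         (\<forall>\<phi> \<in> L1_weighted \<alpha>. (\<forall>x. 0 \<le> \<phi> x) \<longrightarrow> continuous_on UNIV \<phi> \<longrightarrow>
            (\<exists>x. \<phi> x \<noteq> 0) \<longrightarrow> fourier_bessel \<alpha> \<phi> \<in> strictly_positive_definite)"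
proof (intro conjI ballI impI)
  fix \<phi> assume \<phi>: "\<phi> \<in> L1_weighted \<alpha>" "\<forall>x. 0 \<le> \<phi> x"
  show "fourier_bessel \<alpha> \<phi> \<in> positive_definite"
    using continuous_on_fourier_bessel[OF assms \<phi>(1)] \<phi>(2)
      fourier_bessel_form_nonneg[OF assms \<phi>(1)]
    by (auto simp: positive_definite_def hermitian_form_def)
next
  fix \<phi> assume \<phi>: "\<phi> \<in> L1_weighted \<alpha>" "\<forall>x. 0 \<le> \<phi> x" "continuous_on UNIV \<phi>" "\<exists>x. \<phi> x \<noteq> 0"
  then obtain s where s: "\<phi> s \<noteq> 0" by blast
  have "0 < (\<Sum>j=1..N. \<Sum>k=1..N. z j * cnj (z k) * fourier_bessel \<alpha> \<phi> (x j - x k))"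
    if "inj_on x {1..N}" "j \<in> {1..N}" "z j \<noteq> 0" for N x z and j :: nat
    using fourier_bessel_form_pos[where z = z, OF assms \<phi>(1) _ \<phi>(3) s _ that] \<phi>(2)
    by (simp add: hermitian_form_def)
  then show "fourier_bessel \<alpha> \<phi> \<in> strictly_positive_definite"
    using continuous_on_fourier_bessel[OF assms \<phi>(1)] \<phi>(2)
    unfolding strictly_positive_definite_def by blast
qed

end
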